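(* Let $\mathbf{A} = [a_{ij}]$ be an incomplete pairwise comparison matrix of order $4$ whose associated graph $G$ is connected. Then, independently of the number of unknown comparisons in $\mathbf{A}$, the logarithmic least squares optimal completion of $\mathbf{A}$ and the eigenvalue optimal completion of $\mathbf{A}$ are the same matrix.
   Context: Let $\mathbb{R}_+$ denote the set of positive real numbers. An incomplete pairwise comparison matrix of order $n$ is an $n\times n$ array $\mathbf{A}=[a_{ij}]$ with entries $a_{ij}\in\mathbb{R}_+\cup\{\ast\}$ (where $\ast$ indicates a missing entry) such that for all $1\le i,j\le n$: $a_{ij}\in\mathbb{R}_+$ implies $a_{ji}=1/a_{ij}$, and $a_{ij}=\ast$ implies $a_{ji}=\ast$. Diagonal entries are known, so $a_{ii}=1$. The matrix is complete if it has no missing entries. Associated graph: the undirected graph $G=(V,E)$ with $V=\{1,\dots,n\}$ and, for $i\ne j$, $(i,j)\in E$ if and only if $a_{ij}\neq\ast$. Logarithmic least squares optimal completion: let $\mathbf{w}=[w_i]\in\mathbb{R}^n_+$ be an optimal solution of $$\min \sum_{i,j:\, a_{ij}\neq\ast}\left[\log a_{ij}-\log\left(\frac{w_i}{w_j}\right)\right]^2\quad\text{subject to } w_i>0 \text{ for all } i=1,\dots,n.$$ The logarithmic least squares optimal completion of $\mathbf{A}$ is the complete pairwise comparison matrix $\mathbf{B}=[b_{ij}]$ with $b_{ij}=a_{ij}$ if $a_{ij}\neq\ast$ and $b_{ij}=w_i/w_j$ if $a_{ij}=\ast$. Eigenvalue optimal completion: let $m$ be the number of missing comparisons (unordered pairs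 $\{i,j\}$ with $a_{ij}=\ast$). For $\mathbf{x}\in\mathbb{R}^m_+$, let $\mathbf{A}(\mathbf{x})$ be the complete pairwise comparison matrix obtained from $\mathbf{A}$ by replacing the missing entries $a_{ij}$ with $i<j$ by the coordinates of $\mathbf{x}$ and the missing entries $a_{ji}$ by the corresponding reciprocals. Let $\lambda_{\max}(\mathbf{A}(\mathbf{x}))$ denote the dominant (Perron) eigenvalue of this positive matrix. The eigenvalue optimal completion of $\mathbf{A}$ is $\mathbf{A}(\mathbf{x}^* )$, where $\mathbf{x}^*$ is the minimiser of $\lambda_{\max}(\mathbf{A}(\mathbf{x}))$ over $\mathbf{x}\in\mathbb{R}^m_+$. It is known (Bozóki, Fülöp, Rónyai, 2010) that both optimal completions exist and are unique if and only if $G$ is connected (with $\mathbf{w}$ unique up to multiplication by a positive scalar), so both are well defined here. *)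

theory Defs
  imports
    Jordan_Normal_Form.Char_Poly
    Graph_Theory.Digraph_Component
    "HOL-Library.FuncSet"
begin

(* Rows and columns are indexed by 0, ..., n - 1; a missing entry is None. *)
definition incomplete_pcm :: "nat \<Rightarrow> real option mat \<Rightarrow> bool" where
  "incomplete_pcm n A \<longleftrightarrow>
     A \<in> carrier_mat n n \<and>
     (\<forall>i<n. A $$ (i, i) = Some 1) \<and>
     (\<forall>i<n. \<forall>j<n.
        (\<forall>a. A $$ (i, j) = Some a \<longrightarrow> 0 < a \<and> A $$ (j, i) = Some (1 / a)) \<and>
        (A $$ (i, j) = None \<longrightarrow> A $$ (j, i) = None))"

(* The undirected edge between i and j is represented by the two arcs (i, j) and (j, i). *)
definition associated_graph :: "real option mat \<Rightarrow> nat pair_pre_digraph" where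
  "associated_graph A =
     \<lparr> pverts = {..<dim_row A},
       parcs = {(i, j). i < dim_row A \<and> j < dim_row A \<and> i \<noteq> j \<and> A $$ (i, j) \<noteq> None} \<rparr>"

definition known :: "real option mat \<Rightarrow> (nat \<times> nat) set" where
  "known A = {(i, j). i < dim_row A \<and> j < dim_row A \<and> A $$ (i, j) \<noteq> None}"

definition lls_objective :: "real option mat \<Rightarrow> real vec \<Rightarrow> real" where
  "lls_objective A w =
     (\<Sum>(i, j)\<in>known A. (ln (the (A $$ (i, j))) - ln (w $ i / w $ j))\<^sup>2)"

definition lls_optimal_weights :: "real option mat \<Rightarrow> real vec \<Rightarrow> bool" where
  "lls_optimal_weights A w \<longleftrightarrow>
     is_arg_min (lls_objective A)
       (\<lambda>w. w \<in> carrier_vec (dim_row A) \<and> (\<forall>i<dim_row A. 0 < w $ i)) w"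

definition lls_optimal_completion :: "real option mat \<Rightarrow> real mat \<Rightarrow> bool" where
  "lls_optimal_completion A B \<longleftrightarrow>
     (\<exists>w. lls_optimal_weights A w \<and>
          B = mat (dim_row A) (dim_row A)
                (\<lambda>(i, j). case A $$ (i, j) of Some a \<Rightarrow> a | None \<Rightarrow> w $ i / w $ j))"

definition missing :: "real option mat \<Rightarrow> (nat \<times> nat) set" where
  "missing A = {(i, j). i < j \<and> j < dim_row A \<and> A $$ (i, j) = None}"

(* The coordinates of x are indexed by the m missing positions above the diagonal. *)
definition fill :: "real option mat \<Rightarrow> (nat \<times> nat \<Rightarrow> real) \<Rightarrow> real mat" where
  "fill A x = mat (dim_row A) (dim_row A)
     (\<lambda>(i, j). case A $$ (i, j) of Some a \<Rightarrow> a
        | None \<Rightarrow> if i < j then x (i, j) else 1 / x (j, i))"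

(* By Perron's theorem this is well defined for square matrices with positive entries.
   The eigenvalues compared with r are all complex eigenvalues of M. *)
definition dominant_eigenvalue :: "real mat \<Rightarrow> real" where
  "dominant_eigenvalue M =
     (THE r. eigenvalue M r \<and>
        (\<forall>z. eigenvalue (map_mat complex_of_real M) z \<longrightarrow> cmod z \<le> r))"

definition eigenvalue_optimal_completion :: "real option mat \<Rightarrow> real mat \<Rightarrow> bool" where
  "eigenvalue_optimal_completion A B \<longleftrightarrow>
     (\<exists>x. is_arg_min (\<lambda>x. dominant_eigenvalue (fill A x))
            (\<lambda>x. x \<in> missing A \<rightarrow>\<^sub>E {0<..}) x \<and>
          B = fill A x)"

end

theory Submission
  imports Defs
begin

text \<open>
  The characteristic equation of a reciprocal matrix of order 4 is
  \<open>z\<^sup>3 (z - 4) = (z - 1) T + Q\<close>, where \<open>T\<close> is the sum of \<open>t + 1/t - 2\<close> over the four triads and \<open>Q\<close>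
  the same sum over the three 4-cycles. Its Perron root is the unique real root that is at least 4,
  and it increases strictly with \<open>T\<close> and weakly with \<open>Q\<close>. In logarithmic coordinates, \<open>T\<close> and \<open>Q\<close> are
  sums of hyperbolic cosines, hence convex. The residual matrix of a least squares completion is
  skew-symmetric, has zero row sums, and vanishes at the missing entries; this makes the
  derivatives of both \<open>T\<close> and \<open>Q\<close> in the direction of every missing entry vanish. So the least
  squares completion minimises \<open>T\<close> and \<open>Q\<close> simultaneously, and connectedness makes the minimiser
  of \<open>T\<close> unique.
\<close>

subsection \<open>Convexity of the cycle sums\<close>

text \<open>Squaring the weak bound at \<open>x / 2\<close> gains the positive term
  \<open>x^2 / 4\<close>.\<close>

lemma exp_gt_one_plus:
  fixes x :: real
  assumes "x \<noteq> 0"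
  shows "1 + x < exp x"
proof (cases "1 + x / 2 \<ge> 0")
  case True
  have "1 + x < (1 + x / 2)\<^sup>2"
    using assms zero_less_power2[of x] by (simp add: power2_eq_square field_simps)
  also have "\<dots> \<le> (exp (x / 2))\<^sup>2"
    using True by (intro power_mono exp_ge_add_one_self)
  also have "\<dots> = exp x"
    by (simp flip: exp_double)
  finally show ?thesis .
next
  case False
  then have "1 + x < 0" by simp
  then show ?thesis using exp_gt_zero[of x] by linarith
qed

text \<open>For fixed \<open>x\<close>, \<open>cosh (x + y)\<close> combines \<open>exp y\<close>
  and \<open>exp (-y)\<close> with positive coefficients, so the tangent inequality reduces to
  bounds for \<open>exp\<close>. The strict form is the source of uniqueness.\<close>

lemma cosh_tangent:
  fixes x y :: real
  shows "cosh x + y * sinh x \<le> cosh (x + y)"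
    and "y \<noteq> 0 \<Longrightarrow> cosh x + y * sinh x < cosh (x + y)"
proof -
  have eq: "cosh x + y * sinh x = (exp x * (1 + y) + exp (-x) * (1 + - y)) / 2"
    by (simp add: cosh_field_def sinh_field_def field_simps)
  have eq': "cosh (x + y) = (exp x * exp y + exp (-x) * exp (-y)) / 2"
    by (simp add: cosh_field_def flip: exp_add)
  show "cosh x + y * sinh x \<le> cosh (x + y)"
    unfolding eq eq' by (intro divide_right_mono add_mono mult_left_mono exp_ge_add_one_self) auto
  show "cosh x + y * sinh x < cosh (x + y)" if "y \<noteq> 0"
    unfolding eq eq' using that exp_gt_one_plus[of y] exp_gt_one_plus[of "-y"]
    by (intro divide_strict_right_mono add_strict_mono mult_strict_left_mono) auto
qed

text \<open>The sum T in logarithmic coordinates: for \<open>t = exp s\<close>,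
  \<open>t + 1/t - 2\<close> is \<open>2 * cosh s - 2\<close>. Likewise \<open>tetrad_sum\<close> is
  Q, each 4-cycle being taken in one of its two orientations.\<close>

definition triad_sum :: "(nat \<Rightarrow> nat \<Rightarrow> real) \<Rightarrow> real" where
  "triad_sum l = 2 * cosh (l 0 1 + l 1 2 + l 2 0) + 2 * cosh (l 0 1 + l 1 3 + l 3 0)
     + 2 * cosh (l 0 2 + l 2 3 + l 3 0) + 2 * cosh (l 1 2 + l 2 3 + l 3 1) - 8"

definition tetrad_sum :: "(nat \<Rightarrow> nat \<Rightarrow> real) \<Rightarrow> real" where
  "tetrad_sum l = 2 * cosh (l 0 1 + l 1 2 + l 2 3 + l 3 0)
     + 2 * cosh (l 0 1 + l 1 3 + l 3 2 + l 2 0)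
     + 2 * cosh (l 0 2 + l 2 1 + l 1 3 + l 3 0) - 6"

text \<open>Intended for \<open>x\<close> the change of one entry: it is zero at a known entry, and
  at a missing one the residual vanishes, which makes the two cycle arguments opposite.\<close>

lemma mult_sinh_cancel:
  fixes x s t :: real
  assumes "x \<noteq> 0 \<Longrightarrow> s = - t"
  shows "x * (sinh s + sinh t) = 0"
  using assms by (cases "x = 0") auto

text \<open>Here \<open>e\<close> stands for the residuals and \<open>x\<close> for the logarithmic
  change to another completion. Both sums lie above their tangents at \<open>e\<close>, whose linear
  part vanishes in direction \<open>x\<close>; strict convexity handles the case of
  equality.\<close>

lemma cycle_sums_minimal:
  fixes e x :: "nat \<Rightarrow> nat \<Rightarrow> real"
  assumes e: "\<And>i j. i < 4 \<Longrightarrow> j < 4 \<Longrightarrow> e j i = - e i j"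
    and x: "\<And>i j. i < 4 \<Longrightarrow> j < 4 \<Longrightarrow> x j i = - x i j"
    and row: "\<And>i. i < 4 \<Longrightarrow> (\<Sum>j<4. e i j) = 0"
    and disj: "\<And>i j. i < 4 \<Longrightarrow> j < 4 \<Longrightarrow> x i j \<noteq> 0 \<Longrightarrow> e i j = 0"
  shows "tetrad_sum e \<le> tetrad_sum (\<lambda>i j. e i j + x i j)"
    and "triad_sum (\<lambda>i j. e i j + x i j) \<le> triad_sum e \<Longrightarrow> x 0 1 + x 1 2 + x 2 0 = 0 \<and>
      x 0 1 + x 1 3 + x 3 0 = 0 \<and> x 0 2 + x 2 3 + x 3 0 = 0 \<and> x 1 2 + x 2 3 + x 3 1 = 0"
proof -
  have e': "e 1 0 = - e 0 1" "e 2 0 = - e 0 2" "e 3 0 = - e 0 3"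
    "e 2 1 = - e 1 2" "e 3 1 = - e 1 3" "e 3 2 = - e 2 3"
    and x': "x 1 0 = - x 0 1" "x 2 0 = - x 0 2" "x 3 0 = - x 0 3"
    "x 2 1 = - x 1 2" "x 3 1 = - x 1 3" "x 3 2 = - x 2 3"
    by (rule e x, simp, simp)+
  have "e i i = 0" if "i < 4" for i
    using e[OF that that] by simp
  then have r: "e 0 1 + e 0 2 + e 0 3 = 0" "e 1 2 + e 1 3 = e 0 1"
    "e 0 2 + e 1 2 = e 2 3" "e 0 3 + e 1 3 + e 2 3 = 0"
    using row[of 0] row[of 1] row[of 2] row[of 3] e' by (simp_all add: eval_nat_numeral)
  note d = disj[of 0 1] disj[of 0 2] disj[of 0 3] disj[of 1 2] disj[of 1 3] disj[of 2 3]
  define a b c d f g where "a = e 0 1" "b = e 0 2" "c = e 0 3" "d = e 1 2" "f = e 1 3" "g = e 2 3"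
  define a' b' c' d' f' g'
    where "a' = x 0 1" "b' = x 0 2" "c' = x 0 3" "d' = x 1 2" "f' = x 1 3" "g' = x 2 3"
  note defs = a_b_c_d_f_g_def a'_b'_c'_d'_f'_g'_def
  note r' = r[folded defs] and d' = d[folded defs, simplified]
  \<comment> \<open>Oriented along an edge, the arguments of the two triads through it add up to four times
      its entry of \<open>e\<close>, hence cancel when that entry vanishes; likewise for the two 4-cycles.\<close>
  have z3: "a' * (sinh (a + d - b) + sinh (a + f - c)) = 0"
    "b' * (sinh (- (a + d - b)) + sinh (b + g - c)) = 0"
    "c' * (sinh (- (a + f - c)) + sinh (- (b + g - c))) = 0"
    "d' * (sinh (a + d - b) + sinh (d + g - f)) = 0"
    "f' * (sinh (a + f - c) + sinh (- (d + g - f))) = 0"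
    "g' * (sinh (b + g - c) + sinh (d + g - f)) = 0"
    by (rule mult_sinh_cancel, use r' d' in linarith)+
  have z4: "a' * (sinh (a + d + g - c) + sinh (a + f - g - b)) = 0"
    "b' * (sinh (- (a + f - g - b)) + sinh (b - d + f - c)) = 0"
    "c' * (sinh (- (a + d + g - c)) + sinh (- (b - d + f - c))) = 0"
    "d' * (sinh (a + d + g - c) + sinh (- (b - d + f - c))) = 0"
    "f' * (sinh (a + f - g - b) + sinh (b - d + f - c)) = 0"
    "g' * (sinh (a + d + g - c) + sinh (- (a + f - g - b))) = 0"
    by (rule mult_sinh_cancel, use r' d' in linarith)+
  have combine4: "2 * k1 + 2 * k2 + 2 * k3 + 2 * k4
        = 2 * (k1 + p1 * q1) + 2 * (k2 + p2 * q2) + 2 * (k3 + p3 * q3) + 2 * (k4 + p4 * q4)"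
    if "p1 * q1 + p2 * q2 + p3 * q3 + p4 * q4 = 0" for k1 k2 k3 k4 p1 p2 p3 p4 q1 q2 q3 q4 :: real
    using that by argo
  have combine3: "2 * k1 + 2 * k2 + 2 * k3 = 2 * (k1 + p1 * q1) + 2 * (k2 + p2 * q2) + 2 * (k3 + p3 * q3)"
    if "p1 * q1 + p2 * q2 + p3 * q3 = 0" for k1 k2 k3 p1 p2 p3 q1 q2 q3 :: real
    using that by argo
  \<comment> \<open>The equations \<open>z3\<close> are grouped by entry. Added up and regrouped by
    triad, they give half the derivative of \<open>triad_sum\<close> at \<open>e\<close> in
    direction \<open>x\<close>.\<close>
  have "(a' + d' - b') * sinh (a + d - b) + (a' + f' - c') * sinh (a + f - c)
      + (b' + g' - c') * sinh (b + g - c) + (d' + g' - f') * sinh (d + g - f) = 0"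
    using z3 unfolding sinh_minus ring_distribs left_diff_distrib by linarith
  then have T: "2 * cosh (a + d - b) + 2 * cosh (a + f - c) + 2 * cosh (b + g - c) + 2 * cosh (d + g - f) =
     2 * (cosh (a + d - b) + (a' + d' - b') * sinh (a + d - b))
     + 2 * (cosh (a + f - c) + (a' + f' - c') * sinh (a + f - c))
     + 2 * (cosh (b + g - c) + (b' + g' - c') * sinh (b + g - c))
     + 2 * (cosh (d + g - f) + (d' + g' - f') * sinh (d + g - f))"
    by (rule combine4)
  have "(a' + d' + g' - c') * sinh (a + d + g - c) + (a' + f' - g' - b') * sinh (a + f - g - b)
      + (b' - d' + f' - c') * sinh (b - d + f - c) = 0"
    using z4 unfolding sinh_minus ring_distribs left_diff_distrib by linarith
  then have Q: "2 * cosh (a + d + g - c) + 2 * cosh (a + f - g - b) + 2 * cosh (b - d + f - c) =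
     2 * (cosh (a + d + g - c) + (a' + d' + g' - c') * sinh (a + d + g - c))
     + 2 * (cosh (a + f - g - b) + (a' + f' - g' - b') * sinh (a + f - g - b))
     + 2 * (cosh (b - d + f - c) + (b' - d' + f' - c') * sinh (b - d + f - c))"
    by (rule combine3)
  have Te: "triad_sum e = 2 * cosh (a + d - b) + 2 * cosh (a + f - c)
      + 2 * cosh (b + g - c) + 2 * cosh (d + g - f) - 8"
    and Qe: "tetrad_sum e = 2 * cosh (a + d + g - c) + 2 * cosh (a + f - g - b)
      + 2 * cosh (b - d + f - c) - 6"
    by (simp_all add: triad_sum_def tetrad_sum_def e' defs algebra_simps del: One_nat_def)
  have Tx: "triad_sum (\<lambda>i j. e i j + x i j) = 2 * cosh (a + d - b + (a' + d' - b'))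
      + 2 * cosh (a + f - c + (a' + f' - c'))
      + 2 * cosh (b + g - c + (b' + g' - c')) + 2 * cosh (d + g - f + (d' + g' - f')) - 8"
    and Qx: "tetrad_sum (\<lambda>i j. e i j + x i j) = 2 * cosh (a + d + g - c + (a' + d' + g' - c'))
      + 2 * cosh (a + f - g - b + (a' + f' - g' - b'))
      + 2 * cosh (b - d + f - c + (b' - d' + f' - c')) - 6"
    by (simp_all add: triad_sum_def tetrad_sum_def e' x' defs algebra_simps del: One_nat_def)
  show "tetrad_sum e \<le> tetrad_sum (\<lambda>i j. e i j + x i j)"
    unfolding Qe Qx Q
    by (intro add_mono diff_right_mono mult_left_mono cosh_tangent(1)) auto
  note le = cosh_tangent(1)[of "a + d - b" "a' + d' - b'"] cosh_tangent(1)[of "a + f - c" "a' + f' - c'"]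
    cosh_tangent(1)[of "b + g - c" "b' + g' - c'"] cosh_tangent(1)[of "d + g - f" "d' + g' - f'"]
  note less = cosh_tangent(2)[of "a' + d' - b'" "a + d - b"] cosh_tangent(2)[of "a' + f' - c'" "a + f - c"]
    cosh_tangent(2)[of "b' + g' - c'" "b + g - c"] cosh_tangent(2)[of "d' + g' - f'" "d + g - f"]
  \<comment> \<open>With the total bounded from above, none of the four weak inequalities can be
    strict.\<close>
  have strict_combine: "p1 = 0 \<and> p2 = 0 \<and> p3 = 0 \<and> p4 = 0"
    if "2 * k1 + 2 * k2 + 2 * k3 + 2 * k4 - 8 \<le> 2 * h1 + 2 * h2 + 2 * h3 + 2 * h4 - 8"
      "h1 \<le> k1" "h2 \<le> k2" "h3 \<le> k3" "h4 \<le> k4"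
      "p1 \<noteq> 0 \<Longrightarrow> h1 < k1" "p2 \<noteq> 0 \<Longrightarrow> h2 < k2" "p3 \<noteq> 0 \<Longrightarrow> h3 < k3" "p4 \<noteq> 0 \<Longrightarrow> h4 < k4"
    for h1 h2 h3 h4 k1 k2 k3 k4 p1 p2 p3 p4 :: real
    using that by argo
  assume "triad_sum (\<lambda>i j. e i j + x i j) \<le> triad_sum e"
  then have "a' + d' - b' = 0 \<and> a' + f' - c' = 0 \<and> b' + g' - c' = 0 \<and> d' + g' - f' = 0"
    unfolding Te Tx T by (rule strict_combine[OF _ le less])
  then show "x 0 1 + x 1 2 + x 2 0 = 0 \<and>
      x 0 1 + x 1 3 + x 3 0 = 0 \<and> x 0 2 + x 2 3 + x 3 0 = 0 \<and> x 1 2 + x 2 3 + x 3 1 = 0"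
    by (simp add: x' defs del: One_nat_def)
qed

subsection \<open>Characteristic equation of a reciprocal matrix of order 4\<close>

text \<open>The Leibniz formula sorted by cycle type, with each cycle next to its reverse, so that
  reciprocity can be applied to whole groups of terms.\<close>

lemma det_4:
  assumes A: "(A :: 'a :: comm_ring_1 mat) \<in> carrier_mat 4 4"
  shows "det A = A$$(0,0) * A$$(1,1) * A$$(2,2) * A$$(3,3)
    - A$$(0,1) * A$$(1,0) * A$$(2,2) * A$$(3,3) - A$$(0,2) * A$$(2,0) * A$$(1,1) * A$$(3,3)
    - A$$(0,3) * A$$(3,0) * A$$(1,1) * A$$(2,2) - A$$(1,2) * A$$(2,1) * A$$(0,0) * A$$(3,3)
    - A$$(1,3) * A$$(3,1) * A$$(0,0) * A$$(2,2) - A$$(2,3) * A$$(3,2) * A$$(0,0) * A$$(1,1)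
    + A$$(0,1) * A$$(1,0) * A$$(2,3) * A$$(3,2) + A$$(0,2) * A$$(2,0) * A$$(1,3) * A$$(3,1)
    + A$$(0,3) * A$$(3,0) * A$$(1,2) * A$$(2,1)
    + (A$$(0,1) * A$$(1,2) * A$$(2,0) + A$$(0,2) * A$$(2,1) * A$$(1,0)) * A$$(3,3)
    + (A$$(0,1) * A$$(1,3) * A$$(3,0) + A$$(0,3) * A$$(3,1) * A$$(1,0)) * A$$(2,2)
    + (A$$(0,2) * A$$(2,3) * A$$(3,0) + A$$(0,3) * A$$(3,2) * A$$(2,0)) * A$$(1,1)
    + (A$$(1,2) * A$$(2,3) * A$$(3,1) + A$$(1,3) * A$$(3,2) * A$$(2,1)) * A$$(0,0)
    - (A$$(0,1) * A$$(1,2) * A$$(2,3) * A$$(3,0) + A$$(0,3) * A$$(3,2) * A$$(2,1) * A$$(1,0))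
    - (A$$(0,1) * A$$(1,3) * A$$(3,2) * A$$(2,0) + A$$(0,2) * A$$(2,3) * A$$(3,1) * A$$(1,0))
    - (A$$(0,2) * A$$(2,1) * A$$(1,3) * A$$(3,0) + A$$(0,3) * A$$(3,1) * A$$(1,2) * A$$(2,0))"
proof -
  have 1: "det B = B$$(0,0)" if "B \<in> carrier_mat 1 1" for B :: "'a mat"
    using that by (rule det_single)
  have 2: "det B = B$$(0,0) * B$$(1,1) - B$$(0,1) * B$$(1,0)"
    if B: "B \<in> carrier_mat 2 2" for B :: "'a mat"
    using B by (subst laplace_expansion_row[OF B, of 0])
      (auto simp: eval_nat_numeral cofactor_def 1 mat_delete_def)
  have 3: "det B = B$$(0,0) * (B$$(1,1) * B$$(2,2) - B$$(1,2) * B$$(2,1))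
      + B$$(0,1) * (B$$(1,2) * B$$(2,0) - B$$(1,0) * B$$(2,2))
      + B$$(0,2) * (B$$(1,0) * B$$(2,1) - B$$(1,1) * B$$(2,0))"
    if B: "B \<in> carrier_mat 3 3" for B :: "'a mat"
    using B by (subst laplace_expansion_row[OF B, of 0])
      (auto simp: numeral_3_eq_3 cofactor_def 2[unfolded numeral_2_eq_2] mat_delete_def numeral_2_eq_2)
  have s: "{..<4} = {0,1,2,3::nat}" by auto
  have c: "mat_delete A 0 j \<in> carrier_mat 3 3" for j
    using A by (simp add: mat_delete_def)
  show ?thesis
    using A unfolding laplace_expansion_row[OF A, of 0, simplified] s
    by (simp add: cofactor_def 3[OF c] power3_eq_cube)
      (simp add: mat_delete_def numeral_2_eq_2 numeral_3_eq_3 algebra_simps)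
qed

text \<open>Stated over any field because it is applied both to a real matrix and to its
  complexification.\<close>

definition triads :: "'a :: field mat \<Rightarrow> 'a" where
  "triads M = M$$(0,1) * M$$(1,2) * M$$(2,0) + M$$(0,2) * M$$(2,1) * M$$(1,0)
    + M$$(0,1) * M$$(1,3) * M$$(3,0) + M$$(0,3) * M$$(3,1) * M$$(1,0)
    + M$$(0,2) * M$$(2,3) * M$$(3,0) + M$$(0,3) * M$$(3,2) * M$$(2,0)
    + M$$(1,2) * M$$(2,3) * M$$(3,1) + M$$(1,3) * M$$(3,2) * M$$(2,1) - 8"

definition tetrads :: "'a :: field mat \<Rightarrow> 'a" where
  "tetrads M = M$$(0,1) * M$$(1,2) * M$$(2,3) * M$$(3,0) + M$$(0,3) * M$$(3,2) * M$$(2,1) * M$$(1,0)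
    + M$$(0,1) * M$$(1,3) * M$$(3,2) * M$$(2,0) + M$$(0,2) * M$$(2,3) * M$$(3,1) * M$$(1,0)
    + M$$(0,2) * M$$(2,1) * M$$(1,3) * M$$(3,0) + M$$(0,3) * M$$(3,1) * M$$(1,2) * M$$(2,0) - 6"

text \<open>Transpositions contribute products equal to 1. With \<open>u = 1 - z\<close>, the part
  free of \<open>triads\<close> and \<open>tetrads\<close> is
  \<open>u^4 - 6*u^2 + 8*u - 3 = (u - 1)^3 * (u + 3)\<close>, which is
  \<open>z^3 * (z - 4)\<close>.\<close>

lemma eigenvalue_reciprocal_4:
  fixes M :: "'a :: field mat"
  assumes M: "M \<in> carrier_mat 4 4"
    and diag: "\<And>i. i < 4 \<Longrightarrow> M $$ (i, i) = 1"
    and recip: "\<And>i j. i < 4 \<Longrightarrow> j < 4 \<Longrightarrow> M $$ (i, j) * M $$ (j, i) = 1"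
  shows "eigenvalue M z \<longleftrightarrow> z ^ 3 * (z - 4) = (z - 1) * triads M + tetrads M"
proof -
  have c: "char_matrix M z \<in> carrier_mat 4 4"
    using M by simp
  have off: "char_matrix M z $$ (i, j) = M $$ (i, j)" if "i < 4" "j < 4" "i \<noteq> j" for i j
    using that M by (simp add: char_matrix_def)
  have on: "char_matrix M z $$ (i, i) = 1 - z" if "i < 4" for i
    using that M diag[OF that] by (simp add: char_matrix_def)
  have "det (char_matrix M z) = z ^ 3 * (z - 4) - ((z - 1) * triads M + tetrads M)"
    unfolding det_4[OF c] triads_def tetrads_def
    by (simp add: off on recip)
      (simp add: algebra_simps recip power3_eq_cube mult.assoc)
  then show ?thesis
    unfolding eigenvalue_det[OF M] by simp
qed

subsection \<open>The dominant root\<close>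

text \<open>After division by \<open>s - 1\<close>, the quartic side strictly increases on
  \<open>s \<ge> 4\<close>, while \<open>T + Q / (s - 1)\<close> does not increase. The proof is
  this argument with denominators cleared.\<close>

lemma quartic_pos_beyond_root:
  fixes r s T Q :: real
  assumes r: "4 \<le> r" "r ^ 3 * (r - 4) = (r - 1) * T + Q" and s: "r < s" and Q: "0 \<le> Q"
  shows "(s - 1) * T + Q < s ^ 3 * (s - 4)"
proof -
  have "(s - 1) * (r - 4) < (r - 1) * (s - 4)"
    using s by (simp add: algebra_simps)
  then have "r ^ 3 * ((s - 1) * (r - 4)) < r ^ 3 * ((r - 1) * (s - 4))"
    using r by (intro mult_strict_left_mono) auto
  also have "\<dots> \<le> s ^ 3 * ((r - 1) * (s - 4))"
    using r s by (intro mult_right_mono power_mono) auto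
  finally have "(s - 1) * (r ^ 3 * (r - 4)) < (r - 1) * (s ^ 3 * (s - 4))"
    by (simp add: mult_ac)
  then have *: "(s - 1) * ((r - 1) * T + Q) < (r - 1) * (s ^ 3 * (s - 4))"
    unfolding r(2) .
  have "(r - 1) * Q \<le> (s - 1) * Q"
    using s Q by (intro mult_right_mono) auto
  then have "(r - 1) * ((s - 1) * T + Q) < (r - 1) * (s ^ 3 * (s - 4))"
    using * by (simp add: algebra_simps)
  then show ?thesis
    using r by simp
qed

lemma quartic_root_exists:
  fixes T Q :: real
  assumes "0 \<le> T" "0 \<le> Q"
  obtains r where "4 \<le> r" "r ^ 3 * (r - 4) = (r - 1) * T + Q"
proof -
  define f where "f = (\<lambda>r::real. r ^ 3 * (r - 4) - ((r - 1) * T + Q))"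
  \<comment> \<open>Large enough that \<open>R - 4 \<ge> T + Q\<close> and
    \<open>R ^ 3 \<ge> R\<close>.\<close>
  define R where "R = 5 + T + Q"
  have "(R - 1) * T + Q \<le> R * T + R * Q"
    using assms mult_right_mono[of 1 R Q] by (simp add: R_def algebra_simps)
  also have "\<dots> = R * (T + Q)"
    by (simp add: algebra_simps)
  also have "\<dots> \<le> R ^ 3 * (R - 4)"
    using assms power_increasing[of 1 3 R] by (intro mult_mono) (auto simp: R_def)
  finally have "0 \<le> f R"
    by (simp add: f_def)
  moreover have "f 4 \<le> 0"
    using assms by (simp add: f_def)
  moreover have "continuous_on {4..R} f"
    unfolding f_def by (intro continuous_intros)
  ultimately obtain r where "4 \<le> r" "f r = 0"
    using IVT'[of f 4 0 R] assms by (auto simp: R_def)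
  then show thesis
    using that by (simp add: f_def)
qed

text \<open>With \<open>s = cmod z\<close> and \<open>d = cmod (z - 4)\<close>, taking norms gives
  \<open>s^3 * d \<le> (d + 3) * T + Q\<close>. Since \<open>((d + 3) * T + Q) / d\<close> does not
  increase in \<open>d\<close>, and \<open>d \<ge> s - 4\<close>, the bound persists at
  \<open>d = s - 4\<close>; for \<open>s > r\<close> this contradicts positivity beyond the
  root.\<close>

lemma quartic_root_cmod_le:
  fixes r T Q :: real and z :: complex
  assumes r: "4 \<le> r" "r ^ 3 * (r - 4) = (r - 1) * T + Q" and T: "0 \<le> T" and Q: "0 \<le> Q"
    and z: "z ^ 3 * (z - 4) = (z - 1) * of_real T + of_real Q"
  shows "cmod z \<le> r"
proof (rule ccontr)
  define s where "s = cmod z"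
  assume "\<not> cmod z \<le> r"
  then have s: "r < s" "4 < s"
    using r by (auto simp: s_def)
  define d where "d = cmod (z - 4)"
  have d: "s - 4 \<le> d"
    using norm_triangle_ineq2[of z 4] by (simp add: s_def d_def)
  have "cmod (z - 1) \<le> d + 3"
    using norm_triangle_ineq[of "z - 4" 3] by (simp add: d_def)
  have "s ^ 3 * d = cmod ((z - 1) * of_real T + of_real Q)"
    unfolding s_def d_def using arg_cong[OF z, of cmod] by (simp add: norm_mult norm_power)
  also have "\<dots> \<le> cmod ((z - 1) * of_real T) + cmod (of_real Q)"
    by (rule norm_triangle_ineq)
  also have "\<dots> \<le> (d + 3) * T + Q"
    using T Q \<open>cmod (z - 1) \<le> d + 3\<close> by (simp add: norm_mult mult_right_mono)
  finally have le: "s ^ 3 * d \<le> (d + 3) * T + Q" .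
  have "(s - 4) * ((d + 3) * T + Q) \<le> d * ((s - 1) * T + Q)"
  proof -
    have "d * ((s - 1) * T + Q) - (s - 4) * ((d + 3) * T + Q) = (d - (s - 4)) * (3 * T + Q)"
      by (simp add: algebra_simps)
    also have "\<dots> \<ge> 0"
      using d T Q by simp
    finally show ?thesis by simp
  qed
  also have "\<dots> < d * (s ^ 3 * (s - 4))"
    using quartic_pos_beyond_root[OF r s(1) Q] d s by (intro mult_strict_left_mono) auto
  also have "\<dots> = (s - 4) * (s ^ 3 * d)"
    by simp
  also have "\<dots> \<le> (s - 4) * ((d + 3) * T + Q)"
    using le s by (intro mult_left_mono) auto
  finally show False by simp
qed

section \<open>Reciprocal matrices in logarithmic coordinates\<close>

definition reciprocal :: "nat \<Rightarrow> real mat \<Rightarrow> bool" where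
  "reciprocal n M \<longleftrightarrow> M \<in> carrier_mat n n \<and>
     (\<forall>i<n. \<forall>j<n. 0 < M $$ (i, j) \<and> M $$ (j, i) = 1 / M $$ (i, j))"

definition log_entry :: "real mat \<Rightarrow> nat \<Rightarrow> nat \<Rightarrow> real" where
  "log_entry M i j = ln (M $$ (i, j))"

lemma reciprocalD:
  assumes "reciprocal n M" "i < n" "j < n"
  shows "0 < M $$ (i, j)" "M $$ (j, i) = 1 / M $$ (i, j)"
  using assms unfolding reciprocal_def by blast+

lemma reciprocal_carrier: "reciprocal n M \<Longrightarrow> M \<in> carrier_mat n n"
  unfolding reciprocal_def by blast

lemma reciprocal_diag:
  assumes "reciprocal n M" "i < n"
  shows "M $$ (i, i) = 1"
proof -
  have "x = 1" if "0 < x" "x = 1 / x" for x :: real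
  proof -
    have "x * x = 1"
      using that by (metis less_irrefl nonzero_eq_divide_eq)
    then have "x\<^sup>2 = 1"
      by (simp add: power2_eq_square)
    then show ?thesis
      using that(1) by (auto simp: power2_eq_1_iff)
  qed
  then show ?thesis
    using reciprocalD[OF assms assms(2)] .
qed

lemma log_entry_swap:
  assumes "reciprocal n M" "i < n" "j < n"
  shows "log_entry M j i = - log_entry M i j"
  using reciprocalD[OF assms] by (simp add: log_entry_def ln_div)

lemma exp_log_entry:
  assumes "reciprocal n M" "i < n" "j < n"
  shows "exp (log_entry M i j) = M $$ (i, j)"
  using reciprocalD[OF assms] by (simp add: log_entry_def)

lemma
  assumes M: "reciprocal 4 M"
  shows triads_eq: "triads M = triad_sum (log_entry M)"
    and tetrads_eq: "tetrads M = tetrad_sum (log_entry M)"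
proof -
  have inv: "M $$ (j, i) = exp (- log_entry M i j)" if "i < 4" "j < 4" for i j
    using exp_log_entry[OF M that(2,1)] log_entry_swap[OF M that] by simp
  have two_cosh: "2 * cosh t = exp t + exp (- t)" for t :: real
    by (simp add: cosh_field_def)
  have c3: "M $$ (i, j) * M $$ (j, k) * M $$ (k, i) + M $$ (i, k) * M $$ (k, j) * M $$ (j, i)
      = 2 * cosh (log_entry M i j + log_entry M j k + log_entry M k i)"
    if "i < 4" "j < 4" "k < 4" for i j k
    unfolding two_cosh inv[OF that(1,2)] inv[OF that(2,3)] inv[OF that(3,1)]
    by (simp only: minus_add_distrib exp_add exp_log_entry[OF M] that mult_ac)
  have c4: "M $$ (i, j) * M $$ (j, k) * M $$ (k, l) * M $$ (l, i)
      + M $$ (i, l) * M $$ (l, k) * M $$ (k, j) * M $$ (j, i)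
      = 2 * cosh (log_entry M i j + log_entry M j k + log_entry M k l + log_entry M l i)"
    if "i < 4" "j < 4" "k < 4" "l < 4" for i j k l
    unfolding two_cosh inv[OF that(1,2)] inv[OF that(2,3)] inv[OF that(3,4)] inv[OF that(4,1)]
    by (simp only: minus_add_distrib exp_add exp_log_entry[OF M] that mult_ac)
  have n: "0 < (4::nat)" "1 < (4::nat)" "2 < (4::nat)" "3 < (4::nat)"
    by simp_all
  show "triads M = triad_sum (log_entry M)"
    unfolding triads_def triad_sum_def c3[OF n(1,2,3), symmetric] c3[OF n(1,2,4), symmetric]
      c3[OF n(1,3,4), symmetric] c3[OF n(2,3,4), symmetric]
    by (simp only: add.assoc)
  show "tetrads M = tetrad_sum (log_entry M)"
    unfolding tetrads_def tetrad_sum_def c4[OF n(1,2,3,4), symmetric] c4[OF n(1,2,4,3), symmetric]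
      c4[OF n(1,3,2,4), symmetric]
    by (simp only: add.assoc)
qed

lemma triad_sum_nonneg: "0 \<le> triad_sum l"
proof -
  have "0 \<le> 2 * cosh a + 2 * cosh b + 2 * cosh c + 2 * cosh d - 8" for a b c d :: real
    using cosh_real_ge_1[of a] cosh_real_ge_1[of b] cosh_real_ge_1[of c] cosh_real_ge_1[of d] by simp
  then show ?thesis
    unfolding triad_sum_def .
qed

lemma tetrad_sum_nonneg: "0 \<le> tetrad_sum l"
proof -
  have "0 \<le> 2 * cosh a + 2 * cosh b + 2 * cosh c - 6" for a b c :: real
    using cosh_real_ge_1[of a] cosh_real_ge_1[of b] cosh_real_ge_1[of c] by simp
  then show ?thesis
    unfolding tetrad_sum_def .
qed

text \<open>Evaluates the definite description: some real root is at least 4, and it bounds the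
  modulus of every complex root.\<close>

lemma dominant_eigenvalue_reciprocal_4:
  assumes M: "reciprocal 4 M"
  defines "r \<equiv> dominant_eigenvalue M"
  shows "4 \<le> r"
    and "r ^ 3 * (r - 4) = (r - 1) * triad_sum (log_entry M) + tetrad_sum (log_entry M)"
proof -
  let ?T = "triad_sum (log_entry M)" and ?Q = "tetrad_sum (log_entry M)"
  let ?C = "map_mat complex_of_real M"
  have C: "?C \<in> carrier_mat 4 4"
    using reciprocal_carrier[OF M] by simp
  have entry: "?C $$ (i, j) = of_real (M $$ (i, j))" if "i < 4" "j < 4" for i j
    using reciprocal_carrier[OF M] that by simp
  have real_ev: "eigenvalue M z \<longleftrightarrow> z ^ 3 * (z - 4) = (z - 1) * ?T + ?Q" for z
    unfolding triads_eq[OF M, symmetric] tetrads_eq[OF M, symmetric]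
  proof (rule eigenvalue_reciprocal_4[OF reciprocal_carrier[OF M]])
    show "M $$ (i, j) * M $$ (j, i) = 1" if "i < 4" "j < 4" for i j
      using reciprocalD[OF M that] by simp
  qed (rule reciprocal_diag[OF M])
  have "eigenvalue ?C z \<longleftrightarrow> z ^ 3 * (z - 4) = (z - 1) * triads ?C + tetrads ?C" for z
  proof (rule eigenvalue_reciprocal_4[OF C])
    show "?C $$ (i, j) * ?C $$ (j, i) = 1" if "i < 4" "j < 4" for i j
      using reciprocalD[OF M that] that by (simp add: entry)
    show "?C $$ (i, i) = 1" if "i < 4" for i
      using reciprocal_diag[OF M that] that by (simp add: entry)
  qed
  moreover have "triads ?C = of_real ?T" "tetrads ?C = of_real ?Q"
    unfolding triads_eq[OF M, symmetric] tetrads_eq[OF M, symmetric]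
    by (simp_all add: triads_def tetrads_def entry del: index_map_mat One_nat_def)
  ultimately have complex_ev:
    "eigenvalue ?C z \<longleftrightarrow> z ^ 3 * (z - 4) = (z - 1) * of_real ?T + of_real ?Q" for z
    by simp
  obtain s where s: "4 \<le> s" "s ^ 3 * (s - 4) = (s - 1) * ?T + ?Q"
    using quartic_root_exists triad_sum_nonneg tetrad_sum_nonneg by metis
  have bound: "cmod z \<le> s" if "eigenvalue ?C z" for z
    using quartic_root_cmod_le[OF s triad_sum_nonneg tetrad_sum_nonneg] that complex_ev by blast
  have lift: "eigenvalue ?C (of_real t)" if "eigenvalue M t" for t
    using arg_cong[OF that[unfolded real_ev], of complex_of_real] by (simp add: complex_ev)
  have "dominant_eigenvalue M = s"
    unfolding dominant_eigenvalue_def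
  proof (rule the_equality)
    show "eigenvalue M s \<and> (\<forall>z. eigenvalue ?C z \<longrightarrow> cmod z \<le> s)"
      using s bound by (simp add: real_ev)
    fix t assume t: "eigenvalue M t \<and> (\<forall>z. eigenvalue ?C z \<longrightarrow> cmod z \<le> t)"
    \<comment> \<open>Both \<open>s\<close> and \<open>t\<close> are eigenvalues and bounds, so each
      bounds the other.\<close>
    have "cmod (of_real s) \<le> t" "cmod (of_real t) \<le> s"
      using t bound lift s(2)[folded real_ev] by blast+
    then show "t = s" by simp
  qed
  then show "4 \<le> r" "r ^ 3 * (r - 4) = (r - 1) * ?T + ?Q"
    using s by (simp_all add: r_def)
qed

text \<open>Otherwise the root \<open>r\<close> of \<open>M\<close> is at or beyond that of
  \<open>N\<close>, where the quartic side is at least the right-hand side for \<open>N\<close>,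
  which strictly exceeds the one for \<open>M\<close>.\<close>

lemma dominant_eigenvalue_less:
  assumes M: "reciprocal 4 M" and N: "reciprocal 4 N"
    and T: "triad_sum (log_entry M) < triad_sum (log_entry N)"
    and Q: "tetrad_sum (log_entry M) \<le> tetrad_sum (log_entry N)"
  shows "dominant_eigenvalue M < dominant_eigenvalue N"
proof (rule ccontr)
  define r where "r = dominant_eigenvalue M"
  note rM = dominant_eigenvalue_reciprocal_4[OF M, folded r_def]
  note rN = dominant_eigenvalue_reciprocal_4[OF N]
  assume "\<not> dominant_eigenvalue M < dominant_eigenvalue N"
  then have "(r - 1) * triad_sum (log_entry N) + tetrad_sum (log_entry N) \<le> r ^ 3 * (r - 4)"
    using quartic_pos_beyond_root[OF rN _ tetrad_sum_nonneg, of r] rN(2)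
    by (cases "dominant_eigenvalue N = r") (auto simp: r_def)
  moreover have "(r - 1) * triad_sum (log_entry M) < (r - 1) * triad_sum (log_entry N)"
    using rM(1) T by simp
  ultimately show False
    using rM(2) Q by linarith
qed

subsection \<open>Completions\<close>

definition completion :: "nat \<Rightarrow> real option mat \<Rightarrow> real mat \<Rightarrow> bool" where
  "completion n A B \<longleftrightarrow> reciprocal n B \<and>
     (\<forall>i<n. \<forall>j<n. \<forall>a. A $$ (i, j) = Some a \<longrightarrow> B $$ (i, j) = a)"

lemma incomplete_pcm_dim: "incomplete_pcm n A \<Longrightarrow> dim_row A = n"
  by (auto simp: incomplete_pcm_def)

lemma incomplete_pcm_Some:
  assumes "incomplete_pcm n A" "i < n" "j < n" "A $$ (i, j) = Some a"
  shows "0 < a" "A $$ (j, i) = Some (1 / a)"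
  using assms unfolding incomplete_pcm_def by blast+

lemma incomplete_pcm_None:
  assumes "incomplete_pcm n A" "i < n" "j < n" "A $$ (i, j) = None"
  shows "A $$ (j, i) = None"
  using assms unfolding incomplete_pcm_def by blast+

lemma incomplete_pcm_diag: "incomplete_pcm n A \<Longrightarrow> i < n \<Longrightarrow> A $$ (i, i) = Some 1"
  by (simp add: incomplete_pcm_def)

lemma completion_fill:
  assumes A: "incomplete_pcm n A" and x: "x \<in> missing A \<rightarrow>\<^sub>E {0<..}"
  shows "completion n A (fill A x)"
proof -
  note dim = incomplete_pcm_dim[OF A]
  have pos: "0 < x (i, j)" if "i < j" "j < n" "A $$ (i, j) = None" for i j
    using x that by (auto simp: PiE_def Pi_def missing_def dim)
  have "0 < fill A x $$ (i, j) \<and> fill A x $$ (j, i) = 1 / fill A x $$ (i, j)"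
    if ij: "i < n" "j < n" for i j
  proof (cases "A $$ (i, j)")
    case None
    then have "i \<noteq> j"
      using incomplete_pcm_diag[OF A ij(1)] by auto
    then show ?thesis
      using None incomplete_pcm_None[OF A ij None] pos[of i j] pos[of j i] ij
      by (auto simp: fill_def dim)
  next
    case (Some a)
    then show ?thesis
      using incomplete_pcm_Some[OF A ij Some] ij by (simp add: fill_def dim)
  qed
  then have "reciprocal n (fill A x)"
    unfolding reciprocal_def by (intro conjI) (simp add: fill_def dim, blast)
  then show ?thesis
    by (simp add: completion_def fill_def dim)
qed

lemma completion_obtain_fill:
  assumes A: "incomplete_pcm n A" and B: "completion n A B"
  obtains x where "x \<in> missing A \<rightarrow>\<^sub>E {0<..}" "fill A x = B"
proof
  note dim = incomplete_pcm_dim[OF A]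
  have R: "reciprocal n B"
    using B by (simp add: completion_def)
  \<comment> \<open>The restriction makes the function extensional, as membership in the product set
    demands; entries below the diagonal are recovered by reciprocity.\<close>
  let ?x = "restrict (($$) B) (missing A)"
  show "?x \<in> missing A \<rightarrow>\<^sub>E {0<..}"
    using reciprocalD(1)[OF R] by (auto simp: missing_def dim)
  show "fill A ?x = B"
  proof (rule eq_matI)
    fix i j assume "i < dim_row B" "j < dim_col B"
    then have ij: "i < n" "j < n"
      using reciprocal_carrier[OF R] by auto
    show "fill A ?x $$ (i, j) = B $$ (i, j)"
    proof (cases "A $$ (i, j)")
      case None
      then have "i \<noteq> j"
        using incomplete_pcm_diag[OF A ij(1)] by auto
      then show ?thesis
        using None incomplete_pcm_None[OF A ij None] ij reciprocalD(2)[OF R ij(2,1)]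
        by (auto simp: fill_def dim missing_def)
    next
      case (Some a)
      then show ?thesis
        using B ij by (simp add: fill_def dim completion_def)
    qed
  qed (use reciprocal_carrier[OF R] in \<open>auto simp: fill_def dim\<close>)
qed

text \<open>The matrices \<open>fill A x\<close> are exactly the completions, so a strict minimiser
  among completions is the only optimal one.\<close>

lemma eigenvalue_optimal_completion_unique:
  assumes A: "incomplete_pcm n A" and B: "completion n A B"
    and less: "\<And>C. completion n A C \<Longrightarrow> C \<noteq> B \<Longrightarrow> dominant_eigenvalue B < dominant_eigenvalue C"
  shows "eigenvalue_optimal_completion A C \<longleftrightarrow> C = B"
proof
  obtain y where y: "y \<in> missing A \<rightarrow>\<^sub>E {0<..}" "fill A y = B"
    using completion_obtain_fill[OF A B] by blast
  show "C = B" if "eigenvalue_optimal_completion A C"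
    using that y completion_fill[OF A] less
    unfolding eigenvalue_optimal_completion_def is_arg_min_def by metis
  have "dominant_eigenvalue (fill A y) \<le> dominant_eigenvalue (fill A x)"
    if "x \<in> missing A \<rightarrow>\<^sub>E {0<..}" for x
    using less[OF completion_fill[OF A that]] y(2) by (cases "fill A x = B") auto
  then show "eigenvalue_optimal_completion A C" if "C = B"
    unfolding eigenvalue_optimal_completion_def is_arg_min_linorder using that y by blast
qed

text \<open>Connectedness as propagation along known entries. It is defined through the symmetric
  closure, hence the disjunction in the step.\<close>

lemma connected_associated_graph_induct:
  assumes conn: "Digraph_Component.connected (with_proj (associated_graph A))"
    and ij: "i < dim_row A" "j < dim_row A"
    and base: "P i"
    and step: "\<And>k l. k < dim_row A \<Longrightarrow> l < dim_row A \<Longrightarrow>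
      A $$ (k, l) \<noteq> None \<or> A $$ (l, k) \<noteq> None \<Longrightarrow> P k \<Longrightarrow> P l"
  shows "P j"
proof -
  let ?G = "mk_symmetric (with_proj (associated_graph A))"
  have "i \<rightarrow>\<^sup>*\<^bsub>with_proj ?G\<^esub> j"
    using conn ij by (auto simp: connected_def strongly_connected_def associated_graph_def)
  then have "(i, j) \<in> rtrancl_on (pverts ?G) (parcs ?G)"
    by (simp add: reachable_def)
  then show "P j"
  proof (induction rule: rtrancl_on_induct)
    case base
    show ?case by (fact \<open>P i\<close>)
  next
    case (step k l)
    then show ?case
      using assms(5)[of k l] by (auto simp: parcs_mk_symmetric associated_graph_def)
  qed
qed

text \<open>Here \<open>u\<close> holds the logarithmic weights. If T did not grow strictly, the
  change \<open>x\<close> would be a difference of potentials vanishing at every known entry, and by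
  connectedness it would vanish altogether.\<close>

lemma lls_completion_dominant_eigenvalue_less:
  fixes u :: "nat \<Rightarrow> real"
  assumes A: "incomplete_pcm 4 A"
    and conn: "Digraph_Component.connected (with_proj (associated_graph A))"
    and B: "completion 4 A B" and C: "completion 4 A C" and neq: "C \<noteq> B"
    and row: "\<And>i. i < 4 \<Longrightarrow> (\<Sum>j<4. log_entry B i j - (u i - u j)) = 0"
    and miss: "\<And>i j. i < 4 \<Longrightarrow> j < 4 \<Longrightarrow> A $$ (i, j) = None \<Longrightarrow> log_entry B i j = u i - u j"
  shows "dominant_eigenvalue B < dominant_eigenvalue C"
proof -
  have RB: "reciprocal 4 B" and RC: "reciprocal 4 C"
    using B C by (simp_all add: completion_def)
  note dim = incomplete_pcm_dim[OF A]
  define e where "e i j = log_entry B i j - (u i - u j)" for i j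
  define x where "x i j = log_entry C i j - log_entry B i j" for i j
  have e_swap: "e j i = - e i j" and x_swap: "x j i = - x i j" if "i < 4" "j < 4" for i j
    using log_entry_swap[OF RB that] log_entry_swap[OF RC that] by (simp_all add: e_def x_def)
  have x_known: "x i j = 0" if "i < 4" "j < 4" "A $$ (i, j) \<noteq> None" for i j
    using that B C by (auto simp: x_def log_entry_def completion_def)
  have disj: "e i j = 0" if "i < 4" "j < 4" "x i j \<noteq> 0" for i j
    using x_known[OF that(1,2)] miss[OF that(1,2)] that(3) by (auto simp: e_def)
  have row': "(\<Sum>j<4. e i j) = 0" if "i < 4" for i
    unfolding e_def by (rule row[OF that])
  \<comment> \<open>The weights cancel along every cycle.\<close>
  have eB: "triad_sum e = triad_sum (log_entry B)" "tetrad_sum e = tetrad_sum (log_entry B)"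
    by (simp_all add: triad_sum_def tetrad_sum_def e_def algebra_simps)
  have eC: "triad_sum (\<lambda>i j. e i j + x i j) = triad_sum (log_entry C)"
      "tetrad_sum (\<lambda>i j. e i j + x i j) = tetrad_sum (log_entry C)"
    by (simp_all add: triad_sum_def tetrad_sum_def e_def x_def algebra_simps)
  note min = cycle_sums_minimal[of e x, OF e_swap x_swap row' disj, unfolded eB eC]
  have "triad_sum (log_entry B) < triad_sum (log_entry C)"
  proof (rule ccontr)
    assume "\<not> ?thesis"
    then have z: "x 0 1 + x 1 2 + x 2 0 = 0 \<and> x 0 1 + x 1 3 + x 3 0 = 0 \<and>
        x 0 2 + x 2 3 + x 3 0 = 0 \<and> x 1 2 + x 2 3 + x 3 1 = 0"
      using min(2) by simp
    \<comment> \<open>Zero sums around the triads make \<open>x\<close> additive, so its row 0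
      serves as a potential.\<close>
    have potential: "x i j = x 0 j - x 0 i" if "i < 4" "j < 4" for i j
    proof -
      have "i \<in> {0, 1, 2, 3}" "j \<in> {0, 1, 2, 3}"
        using that by auto
      then show ?thesis
        using z x_swap[of 0 0] x_swap[of 1 1] x_swap[of 2 2] x_swap[of 3 3] x_swap[of 0 1]
          x_swap[of 0 2] x_swap[of 0 3] x_swap[of 1 2] x_swap[of 1 3] x_swap[of 2 3]
        by (elim insertE emptyE) simp_all
    qed
    have "x i j = 0" if "i < 4" "j < 4" for i j
    proof (rule connected_associated_graph_induct[OF conn, where P = "\<lambda>k. x i k = 0" and i = i])
      fix k l
      assume kl: "k < dim_row A" "l < dim_row A" "A $$ (k, l) \<noteq> None \<or> A $$ (l, k) \<noteq> None"
        and "x i k = 0"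
      have "x k l = 0"
        using kl x_known[of k l] x_known[of l k] x_swap[of k l] by (auto simp: dim)
      then show "x i l = 0"
        using \<open>x i k = 0\<close> potential[of i k] potential[of k l] potential[of i l] kl that
        by (simp add: dim)
    qed (use that x_swap[of i i] in \<open>auto simp: dim\<close>)
    then have "C $$ (i, j) = B $$ (i, j)" if "i < 4" "j < 4" for i j
      using exp_log_entry[OF RB that] exp_log_entry[OF RC that] that by (simp add: x_def)
    then have "C = B"
      using reciprocal_carrier[OF RB] reciprocal_carrier[OF RC] by (intro eq_matI) auto
    then show False
      using neq by simp
  qed
  then show ?thesis
    using min(1) by (rule dominant_eigenvalue_less[OF RB RC])
qed

subsection \<open>Least squares\<close>

text \<open>Induction on the number of unknowns: minimising over the last one leaves a least squares
  problem with other data, so \<open>c\<close> and \<open>a\<close> are generalised. Dependent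
  columns are allowed, as weights are determined only up to a factor.\<close>

lemma least_squares_minimiser_exists:
  fixes a :: "'s \<Rightarrow> nat \<Rightarrow> real" and c :: "'s \<Rightarrow> real"
  assumes "finite S"
  shows "\<exists>u. \<forall>v. (\<Sum>s\<in>S. (c s - (\<Sum>k<n. a s k * u k))\<^sup>2) \<le> (\<Sum>s\<in>S. (c s - (\<Sum>k<n. a s k * v k))\<^sup>2)"
proof (induction n arbitrary: c a)
  case 0
  then show ?case by simp
next
  case (Suc n)
  define N where "N = (\<Sum>s\<in>S. (a s n)\<^sup>2)"
  show ?case
  proof (cases "N = 0")
    case True
    then have "a s n = 0" if "s \<in> S" for s
      using that assms by (simp add: N_def sum_nonneg_eq_0_iff)
    then show ?thesis
      using Suc[of c a] by simp
  next
    case False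
    \<comment> \<open>Eliminate the last variable: for given values of the others its optimum is \<open>best\<close>.\<close>
    define best where "best r = (\<Sum>s\<in>S. a s n * r s) / N" for r
    have opt: "(\<Sum>s\<in>S. (r s - a s n * best r)\<^sup>2) \<le> (\<Sum>s\<in>S. (r s - a s n * t)\<^sup>2)" for r t
    proof -
      have Nbest: "N * best r = (\<Sum>s\<in>S. a s n * r s)"
        using False by (simp add: best_def)
      have expand: "(\<Sum>s\<in>S. (r s - a s n * t)\<^sup>2)
        = (\<Sum>s\<in>S. (r s)\<^sup>2) - 2 * t * (N * best r) + t\<^sup>2 * N" for t
        unfolding Nbest by (simp add: N_def power2_diff power_mult_distrib sum.distrib
            sum_subtractf sum_distrib_left mult_ac)
      \<comment> \<open>Completing the square: this is the difference of the two sides.\<close>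
      have "0 \<le> (t - best r)\<^sup>2 * N"
        by (simp add: N_def sum_nonneg)
      then show ?thesis
        unfolding expand by (simp add: power2_eq_square algebra_simps)
    qed
    \<comment> \<open>\<open>c'\<close> and the columns of \<open>a'\<close> are the projections
      orthogonal to the last column of \<open>a\<close>.\<close>
    define c' where "c' s = c s - a s n * best c" for s
    define a' where "a' s k = a s k - a s n * best (\<lambda>s. a s k)" for s k
    have best_lin: "best (\<lambda>s. c s - (\<Sum>k<n. a s k * v k))
        = best c - (\<Sum>k<n. best (\<lambda>s. a s k) * v k)" for v
    proof -
      have "(\<Sum>s\<in>S. a s n * (\<Sum>k<n. a s k * v k)) = (\<Sum>k<n. (\<Sum>s\<in>S. a s n * a s k) * v k)"
        unfolding sum_distrib_left sum_distrib_right by (subst sum.swap) (simp add: mult_ac)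
      then show ?thesis
        by (simp add: best_def right_diff_distrib sum_subtractf diff_divide_distrib
            flip: sum_divide_distrib)
    qed
    have reduced: "c' s - (\<Sum>k<n. a' s k * v k)
        = (c s - (\<Sum>k<n. a s k * v k)) - a s n * best (\<lambda>s. c s - (\<Sum>k<n. a s k * v k))" for s v
      unfolding best_lin
      by (simp add: c'_def a'_def algebra_simps sum_subtractf sum_distrib_left)
    obtain u where u: "(\<Sum>s\<in>S. (c' s - (\<Sum>k<n. a' s k * u k))\<^sup>2)
        \<le> (\<Sum>s\<in>S. (c' s - (\<Sum>k<n. a' s k * v k))\<^sup>2)" for v
      using Suc[of c' a'] by blast
    define w where "w = u(n := best (\<lambda>s. c s - (\<Sum>k<n. a s k * u k)))"
    have "(\<Sum>s\<in>S. (c s - (\<Sum>k<Suc n. a s k * w k))\<^sup>2)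
        \<le> (\<Sum>s\<in>S. (c s - (\<Sum>k<Suc n. a s k * v k))\<^sup>2)" for v
    proof -
      have "(\<Sum>s\<in>S. (c s - (\<Sum>k<Suc n. a s k * w k))\<^sup>2)
          = (\<Sum>s\<in>S. (c' s - (\<Sum>k<n. a' s k * u k))\<^sup>2)"
        unfolding reduced by (simp add: w_def algebra_simps)
      also have "\<dots> \<le> (\<Sum>s\<in>S. (c' s - (\<Sum>k<n. a' s k * v k))\<^sup>2)"
        by (rule u)
      also have "\<dots> \<le> (\<Sum>s\<in>S. (c s - (\<Sum>k<n. a s k * v k) - a s n * v n)\<^sup>2)"
        unfolding reduced by (rule opt)
      also have "\<dots> = (\<Sum>s\<in>S. (c s - (\<Sum>k<Suc n. a s k * v k))\<^sup>2)"
        by (simp add: algebra_simps)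
      finally show ?thesis .
    qed
    then show ?thesis by blast
  qed
qed

section \<open>Existence and stationarity of optimal weights\<close>

lemma finite_known: "finite (known A)"
  by (rule finite_subset[of _ "{..<dim_row A} \<times> {..<dim_row A}"]) (auto simp: known_def)

lemma lls_objective_log:
  assumes "\<And>i. i < dim_row A \<Longrightarrow> 0 < w $ i"
  shows "lls_objective A w = (\<Sum>(i, j)\<in>known A. (ln (the (A $$ (i, j))) - (ln (w $ i) - ln (w $ j)))\<^sup>2)"
proof -
  have "ln (w $ i / w $ j) = ln (w $ i) - ln (w $ j)" if "i < dim_row A" "j < dim_row A" for i j
    using assms[OF that(1)] assms[OF that(2)] by (simp add: ln_div)
  then show ?thesis
    unfolding lls_objective_def by (intro sum.cong) (auto simp: known_def)
qed

lemma lls_optimal_weights_exist: "\<exists>w. lls_optimal_weights A w"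
proof -
  let ?n = "dim_row A"
  \<comment> \<open>Rows of the incidence matrix; the row of a diagonal pair is zero.\<close>
  define a where "a = (\<lambda>(i::nat, j) k. (if i = k then 1 else 0) - (if j = k then 1 else 0) :: real)"
  have diff: "(\<Sum>k<?n. a (i, j) k * v k) = v i - v j" if "(i, j) \<in> known A" for i j and v :: "nat \<Rightarrow> real"
    using that by (simp add: a_def known_def left_diff_distrib sum_subtractf if_distrib[of "\<lambda>x. x * _"] cong: if_cong)
  obtain u where u: "(\<Sum>s\<in>known A. (ln (the (A $$ s)) - (\<Sum>k<?n. a s k * u k))\<^sup>2)
      \<le> (\<Sum>s\<in>known A. (ln (the (A $$ s)) - (\<Sum>k<?n. a s k * v k))\<^sup>2)" for v
    using least_squares_minimiser_exists[OF finite_known[of A],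
        where c = "\<lambda>s. ln (the (A $$ s))" and n = ?n and a = a] by blast
  have obj: "lls_objective A w = (\<Sum>s\<in>known A. (ln (the (A $$ s)) - (\<Sum>k<?n. a s k * ln (w $ k)))\<^sup>2)"
    if "\<And>i. i < ?n \<Longrightarrow> 0 < w $ i" for w
    by (subst lls_objective_log) (auto simp: that diff[where v = "\<lambda>k. ln (w $ k)"] intro!: sum.cong)
  define w where "w = vec ?n (\<lambda>i. exp (u i))"
  have "lls_objective A w = (\<Sum>s\<in>known A. (ln (the (A $$ s)) - (\<Sum>k<?n. a s k * u k))\<^sup>2)"
    by (subst obj) (auto simp: w_def)
  then have "lls_objective A w \<le> lls_objective A w'" if "\<And>i. i < ?n \<Longrightarrow> 0 < w' $ i" for w'
    using u[of "\<lambda>k. ln (w' $ k)"] obj[of w'] that by simp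
  then have "lls_optimal_weights A w"
    unfolding lls_optimal_weights_def is_arg_min_linorder by (auto simp: w_def)
  then show ?thesis by blast
qed

text \<open>Testing with \<open>t = b / d\<close> for a positive \<open>d > c\<close> leaves a value
  below \<open>- b^2 / d\<close>, which is negative unless \<open>b = 0\<close>.\<close>

lemma linear_coefficient_zero:
  fixes b c :: real
  assumes "\<And>t. 0 \<le> t\<^sup>2 * c - 2 * t * b"
  shows "b = 0"
proof (rule ccontr)
  assume b: "b \<noteq> 0"
  define d where "d = \<bar>c\<bar> + 1"
  have d: "0 < d" "c < d"
    by (auto simp: d_def)
  have "(b / d)\<^sup>2 * c < (b / d)\<^sup>2 * d"
    using b d by (intro mult_strict_left_mono) auto
  also have "\<dots> = (b / d) * b"
    using d by (simp add: power2_eq_square)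
  finally have "(b / d)\<^sup>2 * c < (b / d) * b" .
  moreover have "0 < (b / d) * b"
    using b d by (auto simp: zero_less_mult_iff zero_less_divide_iff neq_iff)
  ultimately show False
    using assms[of "b / d"] by simp
qed

text \<open>Stationarity of the objective in the logarithm of the weight \<open>k\<close>, tested by
  scaling that weight by \<open>exp t\<close>.\<close>

lemma lls_normal_equations:
  assumes A: "incomplete_pcm n A" and w: "lls_optimal_weights A w"
    and k: "k < n"
  defines "e \<equiv> \<lambda>i j. if A $$ (i, j) = None then 0
    else ln (the (A $$ (i, j))) - (ln (w $ i) - ln (w $ j))"
  shows "(\<Sum>j<n. e k j) = 0"
proof -
  note dim = incomplete_pcm_dim[OF A]
  have w_pos: "0 < w $ i" if "i < n" for i
    using w that by (auto simp: lls_optimal_weights_def is_arg_min_linorder dim)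
  define \<delta> where "\<delta> i = (if i = k then 1 else 0 :: real)" for i
  define D where "D = (\<lambda>(i, j). \<delta> i - \<delta> j)"
  let ?e = "\<lambda>(i, j). e i j"
  have swap: "e j i = - e i j" if "i < n" "j < n" for i j
  proof (cases "A $$ (i, j)")
    case None
    then show ?thesis
      using incomplete_pcm_None[OF A that None] by (simp add: e_def)
  next
    case (Some a)
    then show ?thesis
      using incomplete_pcm_Some[OF A that Some] by (simp add: e_def ln_div)
  qed
  have perturbed: "(\<Sum>s\<in>known A. (?e s)\<^sup>2) \<le> (\<Sum>s\<in>known A. (?e s - t * D s)\<^sup>2)" for t
  proof -
    define w' where "w' = vec n (\<lambda>i. w $ i * exp (t * \<delta> i))"
    have w'_pos: "0 < w' $ i" if "i < n" for i
      using w_pos[OF that] that by (simp add: w'_def)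
    have "(\<Sum>s\<in>known A. (?e s)\<^sup>2) = lls_objective A w"
      by (subst lls_objective_log) (auto simp: dim w_pos e_def known_def intro!: sum.cong)
    also have "\<dots> \<le> lls_objective A w'"
      using w w'_pos by (auto simp: lls_optimal_weights_def is_arg_min_linorder dim w'_def)
    also have "\<dots> = (\<Sum>s\<in>known A. (?e s - t * D s)\<^sup>2)"
    proof (subst lls_objective_log)
      show "0 < w' $ i" if "i < dim_row A" for i
        using that w'_pos by (simp add: dim)
      have "ln (w' $ i) = ln (w $ i) + t * \<delta> i" if "i < n" for i
        using w_pos[OF that] that by (simp add: w'_def ln_mult)
      then show "(\<Sum>(i, j)\<in>known A. (ln (the (A $$ (i, j))) - (ln (w' $ i) - ln (w' $ j)))\<^sup>2)
          = (\<Sum>s\<in>known A. (?e s - t * D s)\<^sup>2)"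
        by (intro sum.cong) (auto simp: dim e_def known_def D_def algebra_simps)
    qed
    finally show ?thesis .
  qed
  have "0 \<le> t\<^sup>2 * (\<Sum>s\<in>known A. (D s)\<^sup>2) - 2 * t * (\<Sum>s\<in>known A. ?e s * D s)" for t
  proof -
    have "(\<Sum>s\<in>known A. (?e s - t * D s)\<^sup>2) = (\<Sum>s\<in>known A. (?e s)\<^sup>2)
        + (t\<^sup>2 * (\<Sum>s\<in>known A. (D s)\<^sup>2) - 2 * t * (\<Sum>s\<in>known A. ?e s * D s))"
      by (simp add: power2_diff power_mult_distrib sum.distrib sum_subtractf sum_distrib_left mult_ac)
    then show ?thesis
      using perturbed[of t] by linarith
  qed
  then have "(\<Sum>s\<in>known A. ?e s * D s) = 0"
    by (rule linear_coefficient_zero)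
  also have "(\<Sum>s\<in>known A. ?e s * D s) = (\<Sum>s\<in>{..<n} \<times> {..<n}. ?e s * D s)"
    by (rule sum.mono_neutral_left) (auto simp: known_def dim e_def split: if_splits)
  also have "\<dots> = (\<Sum>i<n. \<Sum>j<n. e i j * \<delta> i - e i j * \<delta> j)"
    by (simp add: sum.cartesian_product D_def right_diff_distrib case_prod_unfold)
  also have "\<dots> = (\<Sum>i<n. \<Sum>j<n. e i j * \<delta> i) - (\<Sum>i<n. \<Sum>j<n. e i j * \<delta> j)"
    by (simp add: sum_subtractf)
  also have "(\<Sum>i<n. \<Sum>j<n. e i j * \<delta> i) = (\<Sum>j<n. e k j)"
    using k by (subst sum.swap) (simp add: \<delta>_def if_distrib[of "\<lambda>x. _ * x"] cong: if_cong)
  also have "(\<Sum>i<n. \<Sum>j<n. e i j * \<delta> j) = (\<Sum>i<n. e i k)"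
    using k by (simp add: \<delta>_def if_distrib[of "\<lambda>x. _ * x"] cong: if_cong)
  \<comment> \<open>By skew symmetry the column sum is minus the row sum, so twice the row sum is
    zero.\<close>
  also have "\<dots> = - (\<Sum>j<n. e k j)"
    using k by (simp add: swap[of k] flip: sum_negf)
  finally show ?thesis by simp
qed

text \<open>With \<open>u\<close> the logarithm of optimal weights, missing entries have zero
  residual, so the normal equations extend to full rows of the completed matrix.\<close>

lemma lls_optimal_completion_residuals:
  assumes A: "incomplete_pcm n A" and B: "lls_optimal_completion A B"
  obtains u where "completion n A B"
    "\<And>i. i < n \<Longrightarrow> (\<Sum>j<n. log_entry B i j - (u i - u j)) = 0"
    "\<And>i j. i < n \<Longrightarrow> j < n \<Longrightarrow> A $$ (i, j) = None \<Longrightarrow> log_entry B i j = u i - u j"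
proof -
  note dim = incomplete_pcm_dim[OF A]
  obtain w where w: "lls_optimal_weights A w"
    and B_def: "B = mat n n (\<lambda>(i, j). case A $$ (i, j) of Some a \<Rightarrow> a | None \<Rightarrow> w $ i / w $ j)"
    using B by (auto simp: lls_optimal_completion_def dim)
  have w_pos: "0 < w $ i" if "i < n" for i
    using w that by (auto simp: lls_optimal_weights_def is_arg_min_linorder dim)
  have "0 < B $$ (i, j) \<and> B $$ (j, i) = 1 / B $$ (i, j)" if ij: "i < n" "j < n" for i j
    using ij incomplete_pcm_None[OF A ij] incomplete_pcm_Some[OF A ij] w_pos
    by (cases "A $$ (i, j)") (auto simp: B_def)
  then have "reciprocal n B"
    unfolding reciprocal_def by (intro conjI) (simp add: B_def, blast)
  then have "completion n A B"
    by (simp add: completion_def B_def)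
  moreover have miss: "log_entry B i j = ln (w $ i) - ln (w $ j)"
    if "i < n" "j < n" "A $$ (i, j) = None" for i j
    using that w_pos[OF that(1)] w_pos[OF that(2)] by (simp add: log_entry_def B_def ln_div)
  moreover have "(\<Sum>j<n. log_entry B i j - (ln (w $ i) - ln (w $ j))) = 0" if i: "i < n" for i
  proof -
    have "(\<Sum>j<n. log_entry B i j - (ln (w $ i) - ln (w $ j))) = (\<Sum>j<n. if A $$ (i, j) = None then 0
        else ln (the (A $$ (i, j))) - (ln (w $ i) - ln (w $ j)))"
      using i miss by (intro sum.cong) (auto simp: log_entry_def B_def)
    also have "\<dots> = 0"
      by (rule lls_normal_equations[OF A w i])
    finally show ?thesis .
  qed
  ultimately show thesis
    using that[of "\<lambda>i. ln (w $ i)"] by blast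
qed

theorem theorem1:
  fixes A :: "real option mat"
  assumes "incomplete_pcm 4 A"
    and "Digraph_Component.connected (with_proj (associated_graph A))"
  shows "\<exists>B. (\<forall>C. lls_optimal_completion A C \<longleftrightarrow> C = B) \<and>
             (\<forall>C. eigenvalue_optimal_completion A C \<longleftrightarrow> C = B)"
proof -
  have comp: "completion 4 A B" if "lls_optimal_completion A B" for B
    using lls_optimal_completion_residuals[OF assms(1) that] by blast
  have less: "dominant_eigenvalue B < dominant_eigenvalue C"
    if "lls_optimal_completion A B" "completion 4 A C" "C \<noteq> B" for B C
    by (rule lls_optimal_completion_residuals[OF assms(1) that(1)])
      (rule lls_completion_dominant_eigenvalue_less[OF assms _ that(2,3)])
  obtain B where B: "lls_optimal_completion A B"
    using lls_optimal_weights_exist[of A] by (auto simp: lls_optimal_completion_def)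
  \<comment> \<open>Two distinct least squares completions would each have a smaller dominant
    eigenvalue than the other.\<close>
  have "C = B" if "lls_optimal_completion A C" for C
    using less[OF B comp[OF that]] less[OF that comp[OF B]] by force
  moreover have "eigenvalue_optimal_completion A C \<longleftrightarrow> C = B" for C
    using eigenvalue_optimal_completion_unique[OF assms(1) comp[OF B] less[OF B]] .
  ultimately show ?thesis
    using B by blast
qed

end
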